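(* Let $\Omega_1\subseteq\mathbb{R}^n$ and $\Omega_2\subseteq\mathbb{R}^m$ be open and let $F\in\mathcal{G}[\Omega_1,\Omega_2]$ be a c-bounded generalized map. Then the generalized graph $\operatorname{Graph}(F)$ has the following properties: (i) It extends the classical notion of the graph of a continuous function: if $F$ is the embedding of a continuous function $G=(G_1,\dots,G_m)\in C(\Omega_1,\Omega_2)$, i.e. $F=(\iota(G_1),\dots,\iota(G_m))$, then $\operatorname{Graph}(F)$ coincides with the graph $\{(x,G(x)):x\in\Omega_1\}$ of $G$. (ii) It defines a closed and locally bounded set-valued map $$\Omega_1\to\mathcal{F}_0(\Omega_2),\qquad x\mapsto\operatorname{Graph}(F)_x .$$
   Context: **Colombeau algebra.** For open $\Omega\subseteq\mathbb{R}^n$, $\mathcal{E}_M(\Omega)$ is the set of nets $(u_\varepsilon)_{\varepsilon\in]0,1]}$ in $C^\infty(\Omega)$ such that for every compact $K\subset\Omega$ and $\alpha\in\mathbb{N}_0^n$ there is $p\in\mathbb{R}$ with $\sup_K|\partial^\alpha u_\varepsilon|=O(\varepsilon^{-p})$. $\mathcal{N}(\Omega)$ is the ideal of those moderate nets with $\sup_K|u_\varepsilon|=O(\varepsilon^q)$ for all compact $K$ and all $q$. $\mathcal{G}(\Omega)=\mathcal{E}_M(\Omega)/\mathcal{N}(\Omega)$. $\iota:\mathcal{D}'(\Omega)\to\mathcal{G}(\Omega)$ is the standard (sheaf) embedding, given for compactly supported distributions by convolution with $\rho_\varepsilon=\varepsilon^{-n}\rho(\cdot/\varepsilon)$, where $\rho\in\mathcal{S}(\mathbb{R}^n)$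 has $\int\rho=1$ and all higher moments vanishing. **C-bounded maps.** $\mathcal{G}[\Omega_1,\Omega_2]$ is the set of $F\in\mathcal{G}(\Omega_1)^m$ having a representative $(F_\varepsilon)_\varepsilon$ with $F_\varepsilon\in C^\infty(\Omega_1,\Omega_2)$ such that for every compact $K\subset\Omega_1$ there is a compact $K'\subset\Omega_2$ with $F_\varepsilon(K)\subseteq K'$ for all $\varepsilon\in]0,1]$. **Generalized graph.** Let $\mathcal{T}$ be the set of maps $\tau:]0,1]\to]0,1]$ with $\lim_{\varepsilon\to0}\tau(\varepsilon)=0$. A point $\lambda$ is a cluster point of a net $(\lambda_\varepsilon)_\varepsilon$ iff $\lambda=\lim_{\varepsilon\to0}\lambda_{\tau(\varepsilon)}$ for some $\tau\in\mathcal{T}$. $\operatorname{Graph}(F)$ is the set of $(x,y)\in\Omega_1\times\Omega_2$ for which there are a net $(x_\varepsilon)_\varepsilon$ in $\Omega_1$ with $x_\varepsilon\to x$ and $\tau\in\mathcal{T}$ such that $y$ is a cluster point of $(F_{\tau(\varepsilon)}(x_\varepsilon))_\varepsilon$ (this does not depend on the representative). $\operatorname{Graph}(F)_x=\{y\in\Omega_2:(x,y)\in\operatorname{Graph}(F)\}$. **Set-valued maps.** $\mathcal{F}_0(\Omega_2)$ is the set of non-empty (relatively) closed subsets of $\Omega_2$. A set-valued map $x\mapsto A_x$ on $\Omega_1$ is closed if $\{(x,y):y\in A_x\}$ is closed in $\Omega_1\times\Omega_2$ (relative topology), and locally bounded if every $x\in\Omega_1$ has a neighborhood $X\subseteq\Omega_1$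 with $\bigcup_{x'\in X}A_{x'}$ bounded. *)

theory Defs
  imports "HOL-Analysis.Analysis" "HOL-Library.Landau_Symbols"
begin

text \<open>
  Functions on an open set \<open>\<Omega>\<close> are total functions whose values outside \<open>\<Omega>\<close> are ignored.
  The iterated partial derivative \<open>\<partial>\<^sub>i\<^sub>1 \<dots> \<partial>\<^sub>i\<^sub>k f\<close> is indexed by the list \<open>[i\<^sub>1, \<dots>, i\<^sub>k]\<close> of
  coordinates. On smooth functions the order of the list does not matter, so quantifying over all
  lists amounts to quantifying over all multi-indices; \<open>length\<close> is the order of the derivative.
\<close>

primrec partials :: "'n::finite list \<Rightarrow> (real^'n \<Rightarrow> real) \<Rightarrow> real^'n \<Rightarrow> real" where
  "partials [] f = f"
| "partials (i # is) f = (\<lambda>x. frechet_derivative (partials is f) (at x) (axis i 1))"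

definition smooth_on :: "(real^'n) set \<Rightarrow> (real^'n \<Rightarrow> real) \<Rightarrow> bool" where
  "smooth_on \<Omega> f \<longleftrightarrow> (\<forall>\<alpha>. partials \<alpha> f differentiable_on \<Omega>)"

definition supp :: "(real^'n \<Rightarrow> real) \<Rightarrow> (real^'n) set" where
  "supp \<phi> = closure {x. \<phi> x \<noteq> 0}"

definition test_functions :: "(real^'n) set \<Rightarrow> (real^'n \<Rightarrow> real) set" where
  "test_functions \<Omega> = {\<phi>. smooth_on UNIV \<phi> \<and> compact (supp \<phi>) \<and> supp \<phi> \<subseteq> \<Omega>}"

definition distributions :: "(real^'n) set \<Rightarrow> ((real^'n \<Rightarrow> real) \<Rightarrow> real) set" where
  "distributions \<Omega> = {u.
     (\<forall>\<phi>\<in>test_functions \<Omega>. \<forall>\<psi>\<in>test_functions \<Omega>. \<forall>a b.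
        u (\<lambda>x. a * \<phi> x + b * \<psi> x) = a * u \<phi> + b * u \<psi>) \<and>
     (\<forall>K. compact K \<and> K \<subseteq> \<Omega> \<longrightarrow>
        (\<exists>C N. \<forall>\<phi>\<in>test_functions \<Omega>. supp \<phi> \<subseteq> K \<longrightarrow>
           \<bar>u \<phi>\<bar> \<le> C * (\<Sum>\<alpha> | length \<alpha> \<le> N. SUP x. \<bar>partials \<alpha> \<phi> x\<bar>)))}"

definition regular_distribution ::
    "(real^'n) set \<Rightarrow> (real^'n \<Rightarrow> real) \<Rightarrow> (real^'n \<Rightarrow> real) \<Rightarrow> real" where
  "regular_distribution \<Omega> g \<phi> = (LINT x:\<Omega>|lborel. g x * \<phi> x)"

type_synonym 'n net = "real \<Rightarrow> real^'n \<Rightarrow> real"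

text \<open>
  Only the parameters \<open>\<epsilon> \<in> {0<..1}\<close> are relevant. In the suprema, empty \<open>K\<close> is excluded because
  \<open>Sup {}\<close> is unspecified on the reals.
\<close>

definition moderate_nets :: "(real^'n) set \<Rightarrow> 'n net set" where
  "moderate_nets \<Omega> = {u.
     (\<forall>\<epsilon>\<in>{0<..1}. smooth_on \<Omega> (u \<epsilon>)) \<and>
     (\<forall>K \<alpha>. compact K \<and> K \<noteq> {} \<and> K \<subseteq> \<Omega> \<longrightarrow>
        (\<exists>p::real. (\<lambda>\<epsilon>. SUP x\<in>K. \<bar>partials \<alpha> (u \<epsilon>) x\<bar>) \<in> O[at_right 0](\<lambda>\<epsilon>. \<epsilon> powr (-p))))}"

definition negligible_nets :: "(real^'n) set \<Rightarrow> 'n net set" where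
  "negligible_nets \<Omega> = {u \<in> moderate_nets \<Omega>.
     \<forall>K (q::real). compact K \<and> K \<noteq> {} \<and> K \<subseteq> \<Omega> \<longrightarrow>
        (\<lambda>\<epsilon>. SUP x\<in>K. \<bar>u \<epsilon> x\<bar>) \<in> O[at_right 0](\<lambda>\<epsilon>. \<epsilon> powr q)}"

definition colombeau_rel :: "(real^'n) set \<Rightarrow> ('n net \<times> 'n net) set" where
  "colombeau_rel \<Omega> = {(u, v). u \<in> moderate_nets \<Omega> \<and> v \<in> moderate_nets \<Omega> \<and>
     (\<lambda>\<epsilon> x. u \<epsilon> x - v \<epsilon> x) \<in> negligible_nets \<Omega>}"

definition colombeau :: "(real^'n) set \<Rightarrow> 'n net set set" where
  "colombeau \<Omega> = moderate_nets \<Omega> // colombeau_rel \<Omega>"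

definition monomial :: "('n \<Rightarrow> nat) \<Rightarrow> real^'n::finite \<Rightarrow> real" where
  "monomial \<beta> x = (\<Prod>i\<in>UNIV. (x $ i) ^ \<beta> i)"

definition schwartz :: "(real^'n \<Rightarrow> real) set" where
  "schwartz = {f. smooth_on UNIV f \<and> (\<forall>\<alpha> \<beta>. bounded (range (\<lambda>x. monomial \<beta> x * partials \<alpha> f x)))}"

definition mollifier :: "(real^'n \<Rightarrow> real) \<Rightarrow> bool" where
  "mollifier \<rho> \<longleftrightarrow> \<rho> \<in> schwartz \<and> (LINT x|lborel. \<rho> x) = 1 \<and>
     (\<forall>\<beta>. (\<exists>i. \<beta> i \<noteq> 0) \<longrightarrow> (LINT x|lborel. monomial \<beta> x * \<rho> x) = 0)"

definition scaled :: "(real^'n \<Rightarrow> real) \<Rightarrow> 'n net" where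
  "scaled \<rho> \<epsilon> x = \<rho> (x /\<^sub>R \<epsilon>) / \<epsilon> ^ CARD('n)"

text \<open>
  For \<open>\<psi> \<in> \<D>(\<Omega>)\<close> and \<open>u \<in> \<D>'(\<Omega>)\<close> the product \<open>\<psi>u\<close> is a compactly supported distribution, acting
  on smooth functions by \<open>f \<mapsto> \<langle>u, \<psi>f\<rangle>\<close>. Hence \<open>((\<psi>u) * \<rho>\<^sub>\<epsilon>)(x) = \<langle>u, \<psi> \<rho>\<^sub>\<epsilon>(x - \<cdot>)\<rangle>\<close>.
\<close>

definition cutoff_convolution ::
    "((real^'n \<Rightarrow> real) \<Rightarrow> real) \<Rightarrow> (real^'n \<Rightarrow> real) \<Rightarrow> (real^'n \<Rightarrow> real) \<Rightarrow> 'n net" where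
  "cutoff_convolution u \<psi> \<rho> \<epsilon> x = u (\<lambda>y. \<psi> y * scaled \<rho> \<epsilon> (x - y))"

text \<open>
  The sheaf embedding: \<open>\<iota>(u)\<close> is the unique element of \<open>\<G>(\<Omega>)\<close> whose restriction to every relatively
  compact open \<open>\<omega>\<close> in \<open>\<Omega>\<close> is the class of \<open>(((\<psi>u) * \<rho>\<^sub>\<epsilon>)|\<omega>)\<^sub>\<epsilon>\<close>, where \<open>\<psi> \<in> \<D>(\<Omega>)\<close> is any function
  equal to \<open>1\<close> near the closure of \<open>\<omega>\<close>. It is given here as an equivalence class, i.e. as the set
  of all its representatives.
\<close>

definition iota ::
    "(real^'n \<Rightarrow> real) \<Rightarrow> (real^'n) set \<Rightarrow> ((real^'n \<Rightarrow> real) \<Rightarrow> real) \<Rightarrow> 'n net set" where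
  "iota \<rho> \<Omega> u = {f \<in> moderate_nets \<Omega>.
     \<forall>\<omega> \<psi>. open \<omega> \<and> compact (closure \<omega>) \<and> closure \<omega> \<subseteq> \<Omega> \<and> \<psi> \<in> test_functions \<Omega> \<and>
         (\<exists>V. open V \<and> closure \<omega> \<subseteq> V \<and> (\<forall>x\<in>V. \<psi> x = 1))
       \<longrightarrow> (f, cutoff_convolution u \<psi> \<rho>) \<in> colombeau_rel \<omega>}"

type_synonym ('n, 'm) gen_map = "('n net set)^'m"

definition represents :: "(real \<Rightarrow> real^'n \<Rightarrow> real^'m) \<Rightarrow> ('n, 'm) gen_map \<Rightarrow> bool" where
  "represents f F \<longleftrightarrow> (\<forall>i. (\<lambda>\<epsilon> x. f \<epsilon> x $ i) \<in> F $ i)"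

definition c_bounded ::
    "(real^'n) set \<Rightarrow> (real^'m) set \<Rightarrow> ('n, 'm) gen_map set" where
  "c_bounded \<Omega>1 \<Omega>2 = {F. (\<forall>i. F $ i \<in> colombeau \<Omega>1) \<and>
     (\<exists>f. represents f F \<and>
        (\<forall>\<epsilon>\<in>{0<..1}. (\<forall>i. smooth_on \<Omega>1 (\<lambda>x. f \<epsilon> x $ i)) \<and> f \<epsilon> ` \<Omega>1 \<subseteq> \<Omega>2) \<and>
        (\<forall>K. compact K \<and> K \<subseteq> \<Omega>1 \<longrightarrow>
           (\<exists>K'. compact K' \<and> K' \<subseteq> \<Omega>2 \<and> (\<forall>\<epsilon>\<in>{0<..1}. f \<epsilon> ` K \<subseteq> K'))))}"

definition reparams :: "(real \<Rightarrow> real) set" where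
  "reparams = {\<tau>. \<tau> ` {0<..1} \<subseteq> {0<..1} \<and> (\<tau> \<longlongrightarrow> 0) (at_right 0)}"

definition cluster_point :: "(real \<Rightarrow> 'a::topological_space) \<Rightarrow> 'a \<Rightarrow> bool" where
  "cluster_point l y \<longleftrightarrow> (\<exists>\<tau>\<in>reparams. ((\<lambda>\<epsilon>. l (\<tau> \<epsilon>)) \<longlongrightarrow> y) (at_right 0))"

text \<open>
  The choice of the representative \<open>f\<close> is immaterial: two representatives differ by a net that
  tends to \<open>0\<close> uniformly on compact sets.
\<close>

definition gen_graph ::
    "(real^'n) set \<Rightarrow> (real^'m) set \<Rightarrow> ('n, 'm) gen_map \<Rightarrow> ((real^'n) \<times> (real^'m)) set" where
  "gen_graph \<Omega>1 \<Omega>2 F = {(x, y). x \<in> \<Omega>1 \<and> y \<in> \<Omega>2 \<and>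
     (\<exists>f xs \<tau>. represents f F \<and> xs ` {0<..1} \<subseteq> \<Omega>1 \<and> (xs \<longlongrightarrow> x) (at_right 0) \<and>
        \<tau> \<in> reparams \<and> cluster_point (\<lambda>\<epsilon>. f (\<tau> \<epsilon>) (xs \<epsilon>)) y)}"

definition gen_graph_at ::
    "(real^'n) set \<Rightarrow> (real^'m) set \<Rightarrow> ('n, 'm) gen_map \<Rightarrow> real^'n \<Rightarrow> (real^'m) set" where
  "gen_graph_at \<Omega>1 \<Omega>2 F x = {y \<in> \<Omega>2. (x, y) \<in> gen_graph \<Omega>1 \<Omega>2 F}"

definition nonempty_closed_subsets :: "'b::topological_space set \<Rightarrow> 'b set set" where
  "nonempty_closed_subsets \<Omega>2 = {A. A \<noteq> {} \<and> closedin (top_of_set \<Omega>2) A}"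

definition closed_svmap ::
    "'a::topological_space set \<Rightarrow> 'b::topological_space set \<Rightarrow> ('a \<Rightarrow> 'b set) \<Rightarrow> bool" where
  "closed_svmap \<Omega>1 \<Omega>2 A \<longleftrightarrow> closedin (top_of_set (\<Omega>1 \<times> \<Omega>2)) {(x, y). x \<in> \<Omega>1 \<and> y \<in> A x}"

definition locally_bounded_svmap ::
    "'a::topological_space set \<Rightarrow> ('a \<Rightarrow> 'b::metric_space set) \<Rightarrow> bool" where
  "locally_bounded_svmap \<Omega>1 A \<longleftrightarrow>
     (\<forall>x\<in>\<Omega>1. \<exists>X\<subseteq>\<Omega>1. x \<in> interior X \<and> bounded (\<Union>x'\<in>X. A x'))"

lemma test_function_continuous: "\<phi> \<in> test_functions \<Omega> \<Longrightarrow> continuous_on UNIV \<phi>"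
  unfolding test_functions_def smooth_on_def
  by (metis (no_types, lifting) differentiable_imp_continuous_on mem_Collect_eq partials.simps(1))

lemma test_function_outside: "x \<notin> supp \<phi> \<Longrightarrow> \<phi> x = 0"
  unfolding supp_def using closure_subset[of "{x. \<phi> x \<noteq> 0}"] by auto

lemma regular_distribution_restrict:
  assumes "K \<subseteq> \<Omega>" "supp \<phi> \<subseteq> K"
  shows "regular_distribution \<Omega> g \<phi> = (LINT x:K|lborel. g x * \<phi> x)"
proof -
  have "indicator \<Omega> x *\<^sub>R (g x * \<phi> x) = indicator K x *\<^sub>R (g x * \<phi> x)" for x
  proof (cases "x \<in> K")
    case True
    then show ?thesis using assms(1) by (simp add: subsetD)
  next
    case False
    then have "\<phi> x = 0" using assms(2) test_function_outside by blast
    then show ?thesis by simp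
  qed
  then show ?thesis
    unfolding regular_distribution_def set_lebesgue_integral_def by presburger
qed

lemma regular_distribution_in_distributions:
  assumes g: "continuous_on \<Omega> g"
  shows "regular_distribution \<Omega> g \<in> distributions \<Omega>"
proof -
  have int: "set_integrable lborel K (\<lambda>x. g x * \<phi> x)"
    if "\<phi> \<in> test_functions \<Omega>" "compact K" "K \<subseteq> \<Omega>" for \<phi> K
  proof -
    have "continuous_on K (\<lambda>x. g x * \<phi> x)"
      using continuous_on_mult[OF continuous_on_subset[OF g that(3)]
          continuous_on_subset[OF test_function_continuous[OF that(1)] subset_UNIV]] .
    then show ?thesis
      unfolding set_integrable_def using borel_integrable_compact[OF that(2)] by blast
  qed
  have lin: "regular_distribution \<Omega> g (\<lambda>x. a * \<phi> x + b * \<psi> x) =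
      a * regular_distribution \<Omega> g \<phi> + b * regular_distribution \<Omega> g \<psi>"
    if \<phi>: "\<phi> \<in> test_functions \<Omega>" and \<psi>: "\<psi> \<in> test_functions \<Omega>" for \<phi> \<psi> a b
  proof -
    define K where "K = supp \<phi> \<union> supp \<psi>"
    have K: "compact K" "K \<subseteq> \<Omega>" "supp \<phi> \<subseteq> K" "supp \<psi> \<subseteq> K"
      using \<phi> \<psi> by (auto simp: K_def test_functions_def)
    have "{x. a * \<phi> x + b * \<psi> x \<noteq> 0} \<subseteq> K"
    proof
      fix x assume x: "x \<in> {x. a * \<phi> x + b * \<psi> x \<noteq> 0}"
      show "x \<in> K"
      proof (rule ccontr)
        assume "x \<notin> K"
        then have "\<phi> x = 0" "\<psi> x = 0" using K(3,4) test_function_outside by blast+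
        then show False using x by simp
      qed
    qed
    then have s: "supp (\<lambda>x. a * \<phi> x + b * \<psi> x) \<subseteq> K"
      unfolding supp_def using K(1) by (simp add: closure_minimal compact_imp_closed)
    have "(LINT x:K|lborel. g x * (a * \<phi> x + b * \<psi> x)) =
        (LINT x:K|lborel. a * (g x * \<phi> x) + b * (g x * \<psi> x))"
      by (simp add: algebra_simps)
    also have "\<dots> = a * (LINT x:K|lborel. g x * \<phi> x) + b * (LINT x:K|lborel. g x * \<psi> x)"
      using int[OF \<phi> K(1,2)] int[OF \<psi> K(1,2)] by (subst set_integral_add) auto
    finally show ?thesis
      using K s by (simp add: regular_distribution_restrict)
  qed
  have bnd: "\<bar>regular_distribution \<Omega> g \<phi>\<bar>
      \<le> (LINT x:K|lborel. \<bar>g x\<bar>) * (\<Sum>\<alpha> | length \<alpha> \<le> 0. SUP x. \<bar>partials \<alpha> \<phi> x\<bar>)"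
    if K: "compact K" "K \<subseteq> \<Omega>" and \<phi>: "\<phi> \<in> test_functions \<Omega>" "supp \<phi> \<subseteq> K" for K \<phi>
  proof -
    define M where "M = (SUP x. \<bar>\<phi> x\<bar>)"
    have "compact (\<phi> ` K)"
      using compact_continuous_image[OF continuous_on_subset[OF
          test_function_continuous[OF \<phi>(1)] subset_UNIV] K(1)] .
    then obtain B where "\<forall>y\<in>\<phi> ` K. norm y \<le> B"
      using compact_imp_bounded bounded_iff by metis
    then have B: "\<bar>\<phi> x\<bar> \<le> B" if "x \<in> K" for x
      using that by simp
    have B': "\<bar>\<phi> x\<bar> \<le> max B 0" for x
    proof (cases "x \<in> K")
      case True
      then show ?thesis using B[of x] by simp
    next
      case False
      then have "\<phi> x = 0" using \<phi>(2) test_function_outside by blast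
      then show ?thesis by simp
    qed
    have M: "\<bar>\<phi> x\<bar> \<le> M" for x
      unfolding M_def by (rule cSUP_upper[OF UNIV_I bdd_aboveI2[OF B']])
    have gi: "set_integrable lborel K (\<lambda>x. \<bar>g x\<bar>)"
      unfolding set_integrable_def
      using borel_integrable_compact[OF K(1) continuous_on_rabs[OF continuous_on_subset[OF g K(2)]]] .
    have "\<bar>LINT x:K|lborel. g x * \<phi> x\<bar> \<le> (LINT x:K|lborel. \<bar>g x * \<phi> x\<bar>)"
      using set_integral_norm_bound[OF int[OF \<phi>(1) K]] by simp
    also have "\<dots> \<le> (LINT x:K|lborel. \<bar>g x\<bar> * M)"
      using set_integrable_abs[OF int[OF \<phi>(1) K]] gi M
      by (intro set_integral_mono) (simp_all add: abs_mult mult_left_mono)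
    also have "\<dots> = (LINT x:K|lborel. \<bar>g x\<bar>) * M"
      by simp
    finally show ?thesis
      using K \<phi> by (simp add: regular_distribution_restrict M_def)
  qed
  show ?thesis
    unfolding distributions_def mem_Collect_eq
  proof (intro conjI ballI allI impI)
    fix K assume "compact K \<and> K \<subseteq> \<Omega>"
    then show "\<exists>C N. \<forall>\<phi>\<in>test_functions \<Omega>. supp \<phi> \<subseteq> K \<longrightarrow> \<bar>regular_distribution \<Omega> g \<phi>\<bar>
        \<le> C * (\<Sum>\<alpha> | length \<alpha> \<le> N. SUP x. \<bar>partials \<alpha> \<phi> x\<bar>)"
      using bnd[of K] by (intro exI[of _ "LINT x:K|lborel. \<bar>g x\<bar>"] exI[of _ 0] ballI impI) simp
  qed (rule lin)
qed

end

theory Submission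
  imports Defs
begin

text \<open>
  Fix a representative \<open>f\<close> of \<open>F\<close> that maps each compact set, for all \<open>\<epsilon>\<close> at once, into a compact
  subset of the target. Any other representative differs from \<open>f\<close> by a negligible net, and
  negligible nets tend to \<open>0\<close> along \<open>x\<^sub>\<epsilon> \<rightarrow> x\<close>. So the nested reparametrizations in the generalized
  graph boil down to a single condition on \<open>f\<close> (\<open>gen_graph_iff\<close>): for every \<open>d > 0\<close> there are
  \<open>\<epsilon> < d\<close> and a point \<open>x'\<close> that is \<open>d\<close>-close to \<open>x\<close> whose image \<open>f \<epsilon> x'\<close> is \<open>d\<close>-close to \<open>y\<close>.

  The set-valued part follows from this description. The condition passes to limits of \<open>(x, y)\<close>, so
  the graph is closed. For fixed \<open>x\<close> the values \<open>f \<epsilon> x\<close> stay in a compact subset of the target, so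
  they accumulate there as \<open>\<epsilon> \<rightarrow> 0\<close> and the fibre is non-empty. If \<open>f\<close> maps a closed ball into a
  compact set, then the fibres over the open ball lie in that set, which bounds them locally.

  For the embedding of a continuous \<open>G\<close> one shows that \<open>f \<epsilon>\<^sub>k x\<^sub>k \<rightarrow> G x\<close> whenever \<open>\<epsilon>\<^sub>k \<rightarrow> 0\<close> and
  \<open>x\<^sub>k \<rightarrow> x\<close> (\<open>iota_continuous_tendsto\<close>). Near \<open>x\<close> the components of \<open>f\<close> agree up to negligible nets
  with the convolutions of \<open>\<psi> G\<^sub>i\<close> with \<open>\<rho>\<^sub>\<epsilon>\<close>, where \<open>\<psi>\<close> is a cutoff equal to \<open>1\<close> near \<open>x\<close>; after the
  substitution \<open>y = x - \<epsilon> z\<close> these converge by dominated convergence, since \<open>\<psi> G\<^sub>i\<close> is bounded and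
  continuous and \<open>\<rho>\<close> has integral \<open>1\<close>. Thus the fibre over \<open>x\<close> is contained in \<open>{G x}\<close>, and as it is
  non-empty it equals \<open>{G x}\<close>. The embedding is characterized by its restrictions, tested with cutoff
  functions, so this argument needs at least one such \<open>\<psi>\<close> near every point; it is constructed as a
  tensor product of smooth functions of one variable.
\<close>

section \<open>Smooth functions of one real variable\<close>

text \<open>
  A recursive form of \<open>k\<close>-fold differentiability makes closure properties easy inductions: a product
  or a reciprocal has a derivative built from functions that are differentiable one time fewer.
\<close>

primrec times_differentiable :: "nat \<Rightarrow> (real \<Rightarrow> real) \<Rightarrow> bool" where
  "times_differentiable 0 f \<longleftrightarrow> True"
| "times_differentiable (Suc k) f \<longleftrightarrow>
     (\<exists>f'. (\<forall>t. (f has_real_derivative f' t) (at t)) \<and> times_differentiable k f')"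

definition smooth_real :: "(real \<Rightarrow> real) \<Rightarrow> bool" where
  "smooth_real f \<longleftrightarrow> (\<forall>k. times_differentiable k f)"

lemma times_differentiable_SucI:
  "\<lbrakk>\<And>t. (f has_real_derivative f' t) (at t); times_differentiable k f'\<rbrakk>
    \<Longrightarrow> times_differentiable (Suc k) f"
  by auto

lemma times_differentiable_Suc_imp:
  "times_differentiable (Suc k) f \<Longrightarrow> times_differentiable k f"
proof (induction k arbitrary: f)
  case (Suc k)
  then obtain f' where "\<forall>t. (f has_real_derivative f' t) (at t)" "times_differentiable (Suc k) f'"
    by auto
  with Suc.IH show ?case by auto
qed simp

lemma times_differentiable_add:
  "times_differentiable k f \<Longrightarrow> times_differentiable k g \<Longrightarrow> times_differentiable k (\<lambda>t. f t + g t)"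
proof (induction k arbitrary: f g)
  case (Suc k)
  from Suc.prems obtain f' g' where
    "\<forall>t. (f has_real_derivative f' t) (at t)" "times_differentiable k f'"
    "\<forall>t. (g has_real_derivative g' t) (at t)" "times_differentiable k g'" by auto
  with Suc.IH[of f' g'] show ?case
    by (auto intro!: exI[of _ "\<lambda>t. f' t + g' t"] derivative_intros)
qed simp

lemma times_differentiable_mult:
  "times_differentiable k f \<Longrightarrow> times_differentiable k g \<Longrightarrow> times_differentiable k (\<lambda>t. f t * g t)"
proof (induction k arbitrary: f g)
  case (Suc k)
  from Suc.prems obtain f' g' where
    f': "\<forall>t. (f has_real_derivative f' t) (at t)" "times_differentiable k f'" and
    g': "\<forall>t. (g has_real_derivative g' t) (at t)" "times_differentiable k g'" by auto
  have "times_differentiable k f" "times_differentiable k g"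
    using Suc.prems by (blast intro: times_differentiable_Suc_imp)+
  then have "times_differentiable k (\<lambda>t. f' t * g t + f t * g' t)"
    using f' g' by (intro times_differentiable_add Suc.IH)
  moreover have "\<forall>t. ((\<lambda>t. f t * g t) has_real_derivative f' t * g t + f t * g' t) (at t)"
    using f' g' by (auto intro!: derivative_eq_intros)
  ultimately show ?case by auto
qed simp

lemma times_differentiable_const: "times_differentiable k (\<lambda>t. c)"
proof (induction k arbitrary: c)
  case (Suc k)
  then show ?case by (auto intro!: exI[of _ "\<lambda>t. 0"])
qed simp

lemma times_differentiable_inverse:
  assumes "\<And>t. f t \<noteq> 0"
  shows "times_differentiable k f \<Longrightarrow> times_differentiable k (\<lambda>t. inverse (f t))"
proof (induction k)
  case (Suc k)
  from Suc.prems obtain f' where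
    f': "\<forall>t. (f has_real_derivative f' t) (at t)" "times_differentiable k f'" by auto
  have i: "times_differentiable k (\<lambda>t. inverse (f t))"
    using Suc times_differentiable_Suc_imp by blast
  have "times_differentiable k (\<lambda>t. - 1 * (inverse (f t) * f' t * inverse (f t)))"
    using i f' by (intro times_differentiable_mult times_differentiable_const)
  moreover have "\<forall>t. ((\<lambda>t. inverse (f t)) has_real_derivative
      - 1 * (inverse (f t) * f' t * inverse (f t))) (at t)"
    using f' assms by (auto intro!: derivative_eq_intros)
  ultimately show ?case by auto
qed simp

lemma times_differentiable_affine:
  "times_differentiable k f \<Longrightarrow> times_differentiable k (\<lambda>t. f (c * t + d))"
proof (induction k arbitrary: f)
  case (Suc k)
  from Suc.prems obtain f' where
    f': "\<forall>t. (f has_real_derivative f' t) (at t)" "times_differentiable k f'" by auto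
  show ?case
  proof (rule times_differentiable_SucI)
    show "times_differentiable k (\<lambda>t. f' (c * t + d) * c)"
      using Suc.IH[OF f'(2)] by (intro times_differentiable_mult times_differentiable_const)
    show "((\<lambda>t. f (c * t + d)) has_real_derivative f' (c * t + d) * c) (at t)" for t
    by (rule DERIV_chain2[where f = f]) (use f' in \<open>auto intro!: derivative_eq_intros\<close>)
  qed
qed simp

lemma smooth_real_deriv:
  assumes "smooth_real f"
  shows "(f has_real_derivative deriv f t) (at t)" and "smooth_real (deriv f)"
proof -
  have *: "(\<forall>t. (f has_real_derivative deriv f t) (at t)) \<and> times_differentiable k (deriv f)" for k
  proof -
    have "times_differentiable (Suc k) f" using assms by (simp add: smooth_real_def)
    then obtain f' where f': "\<forall>t. (f has_real_derivative f' t) (at t)" "times_differentiable k f'"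
      by auto
    then have "f' = deriv f" by (metis DERIV_imp_deriv ext)
    with f' show ?thesis by simp
  qed
  then show "(f has_real_derivative deriv f t) (at t)" "smooth_real (deriv f)"
    by (auto simp: smooth_real_def)
qed

text \<open>
  The functions \<open>t\<^sup>-\<^sup>n exp (-1/t)\<close>, extended by \<open>0\<close> to \<open>t \<le> 0\<close>. Allowing every power of \<open>1/t\<close> makes
  the family closed under differentiation up to linear combinations, so that smoothness of
  \<open>exp (-1/t)\<close> follows by proving it for all of them simultaneously.
\<close>

definition flat :: "nat \<Rightarrow> real \<Rightarrow> real" where
  "flat n t = (if t \<le> 0 then 0 else inverse t ^ n * exp (- inverse t))"

lemma flat_tendsto_0: "((\<lambda>t. flat n t) \<longlongrightarrow> 0) (at 0)"
proof -
  have "((\<lambda>x. x ^ n / exp x) \<longlongrightarrow> 0) (at_top :: real filter)"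
    by (rule tendsto_power_div_exp_0)
  then have "((\<lambda>t. inverse t ^ n / exp (inverse t)) \<longlongrightarrow> (0::real)) (at_right 0)"
    by (rule filterlim_compose[OF _ filterlim_inverse_at_top_right])
  then have "(flat n \<longlongrightarrow> 0) (at_right 0)"
    by (rule Lim_transform_eventually)
      (auto simp: eventually_at_filter flat_def exp_minus field_simps)
  moreover have "(flat n \<longlongrightarrow> 0) (at_left 0)"
    by (rule tendsto_eventually) (auto simp: eventually_at_filter flat_def)
  ultimately show ?thesis by (simp add: filterlim_split_at)
qed

lemma flat_has_derivative:
  "(flat n has_real_derivative flat (n + 2) t + - real n * flat (n + 1) t) (at t)"
proof -
  consider "t < 0" | "t = 0" | "t > 0" by linarith
  then show ?thesis
  proof cases
    case 1
    have "((\<lambda>_. 0) has_real_derivative 0) (at t)" by simp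
    then have "(flat n has_real_derivative 0) (at t)"
      by (rule has_field_derivative_transform_within_open[of _ _ _ "{..<0}"])
        (use 1 in \<open>auto simp: flat_def\<close>)
    with 1 show ?thesis by (simp add: flat_def)
  next
    case 2
    \<comment> \<open>The difference quotient at \<open>0\<close> is again a function of the family.\<close>
    have "((\<lambda>h. (flat n (0 + h) - flat n 0) / h) \<longlongrightarrow> 0) (at 0)"
      by (rule Lim_transform_eventually[OF flat_tendsto_0[of "Suc n"]])
        (auto simp: eventually_at_filter flat_def field_simps)
    with 2 show ?thesis by (simp add: DERIV_def flat_def)
  next
    case 3
    have "((\<lambda>t. inverse t ^ n * exp (- inverse t)) has_real_derivative
        real n * inverse t ^ (n - 1) * - (inverse t * inverse t) * exp (- inverse t)
        + inverse t ^ n * (exp (- inverse t) * (inverse t * inverse t))) (at t)"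
      using 3 by (auto intro!: derivative_eq_intros)
    moreover have "real n * inverse t ^ (n - 1) * - (inverse t * inverse t) * exp (- inverse t)
        + inverse t ^ n * (exp (- inverse t) * (inverse t * inverse t))
        = flat (n + 2) t + - real n * flat (n + 1) t"
      using 3 by (cases n) (auto simp: flat_def algebra_simps)
    ultimately have "((\<lambda>t. inverse t ^ n * exp (- inverse t)) has_real_derivative
        flat (n + 2) t + - real n * flat (n + 1) t) (at t)" by simp
    then show ?thesis
      by (rule has_field_derivative_transform_within_open[of _ _ _ "{0<..}"])
        (use 3 in \<open>auto simp: flat_def\<close>)
  qed
qed

lemma times_differentiable_flat: "times_differentiable k (flat n)"
proof (induction k arbitrary: n)
  case (Suc k)
  have "times_differentiable k (\<lambda>t. flat (n + 2) t + - real n * flat (n + 1) t)"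
    by (intro times_differentiable_add times_differentiable_mult times_differentiable_const Suc)
  then show ?case by (rule times_differentiable_SucI[OF flat_has_derivative])
qed simp

text \<open>
  The quotient \<open>e(t) / (e(t) + e(1-t))\<close> with \<open>e(t) = exp (-1/t)\<close> for \<open>t > 0\<close>: its denominator has no
  zero, because \<open>t\<close> and \<open>1 - t\<close> are not both \<open>\<le> 0\<close>.
\<close>

lemma smooth_step:
  obtains s where "smooth_real s" "\<And>t. t \<le> 0 \<Longrightarrow> s t = 0" "\<And>t. t \<ge> 1 \<Longrightarrow> s t = 1"
proof
  let ?d = "\<lambda>t. flat 0 t + flat 0 (- 1 * t + 1)"
  let ?s = "\<lambda>t. flat 0 t * inverse (?d t)"
  have pos: "?d t \<noteq> 0" for t
    using add_pos_pos[of "exp (- inverse t)" "exp (- inverse (1 - t))"]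
    by (simp add: flat_def)
  show "smooth_real ?s"
    unfolding smooth_real_def
    by (intro allI times_differentiable_mult times_differentiable_inverse pos
        times_differentiable_add times_differentiable_flat times_differentiable_affine)
  show "?s t = 0" if "t \<le> 0" for t using that by (simp add: flat_def)
  show "?s t = 1" if "t \<ge> 1" for t using that by (simp add: flat_def)
qed

text \<open>
  The product of a step rising just to the right of \<open>a\<close> and a mirrored step falling just to the left
  of \<open>b\<close>.
\<close>

lemma smooth_bump_real:
  fixes a b x :: real
  assumes "a < x" "x < b"
  obtains h d where "smooth_real h" "d > 0" "\<And>t. \<bar>t - x\<bar> < d \<Longrightarrow> h t = 1"
    "\<And>t. t \<notin> {a..b} \<Longrightarrow> h t = 0"
proof -
  obtain s where s: "smooth_real s" "\<And>t. t \<le> 0 \<Longrightarrow> s t = 0" "\<And>t. t \<ge> 1 \<Longrightarrow> s t = 1"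
    using smooth_step by blast
  define d where "d = min (x - a) (b - x) / 2"
  \<comment> \<open>Both steps take place within distance \<open>d\<close> of the end points, and \<open>x\<close> keeps distance \<open>2 d\<close>.\<close>
  have d: "d > 0" "2 * d \<le> x - a" "2 * d \<le> b - x" using assms by (auto simp: d_def)
  let ?h = "\<lambda>t. s (inverse d * t + - a / d) * s (- inverse d * t + b / d)"
  show ?thesis
  proof (rule that[of ?h d])
    show "smooth_real ?h"
      using s(1) unfolding smooth_real_def
      by (intro allI times_differentiable_mult times_differentiable_affine) auto
    have e: "inverse d * t + - a / d = (t - a) / d" "- inverse d * t + b / d = (b - t) / d" for t
      by (auto simp: divide_inverse algebra_simps)
    show "?h t = 1" if "\<bar>t - x\<bar> < d" for t
      unfolding e using that d by (subst (1 2) s(3)) (auto simp: field_simps)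
    show "?h t = 0" if "t \<notin> {a..b}" for t
      unfolding e using that d s(2)[of "(t - a) / d"] s(2)[of "(b - t) / d"]
      by (auto simp: divide_nonpos_pos not_le)
  qed (use d in auto)
qed

section \<open>Cutoff functions\<close>

lemma tensor_product_has_derivative:
  fixes h :: "'n::finite \<Rightarrow> real \<Rightarrow> real" and x :: "real^'n"
  assumes "\<And>i. smooth_real (h i)"
  shows "((\<lambda>y. \<Prod>i\<in>UNIV. h i (y $ i)) has_derivative
    (\<lambda>v. \<Sum>i\<in>UNIV. deriv (h i) (x $ i) * v $ i * (\<Prod>j\<in>UNIV - {i}. h j (x $ j)))) (at x)"
proof (rule has_derivative_prod)
  fix i
  have "(h i has_derivative (\<lambda>v. deriv (h i) (x $ i) * v)) (at (x $ i))"
    using smooth_real_deriv(1)[OF assms[of i]] by (simp add: has_field_derivative_def)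
  moreover have "((\<lambda>y. y $ i) has_derivative (\<lambda>v. v $ i)) (at x)"
    by (rule bounded_linear_imp_has_derivative) (rule bounded_linear_vec_nth)
  ultimately show "((\<lambda>y. h i (y $ i)) has_derivative (\<lambda>v. deriv (h i) (x $ i) * v $ i)) (at x)"
    using has_derivative_compose by blast
qed

text \<open>
  A partial derivative of a tensor product acts on one factor only, so tensor products of smooth
  functions are stable under partial derivatives.
\<close>

lemma partials_tensor_product:
  fixes h :: "'n::finite \<Rightarrow> real \<Rightarrow> real"
  assumes "\<And>i. smooth_real (h i)"
  shows "\<exists>h'. (\<forall>i. smooth_real (h' i)) \<and>
    partials \<alpha> (\<lambda>y :: real^'n. \<Prod>i\<in>UNIV. h i (y $ i)) = (\<lambda>y. \<Prod>i\<in>UNIV. h' i (y $ i))"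
proof (induction \<alpha>)
  case Nil
  then show ?case using assms by auto
next
  case (Cons j \<alpha>)
  then obtain h' where h': "\<And>i. smooth_real (h' i)"
    "partials \<alpha> (\<lambda>y :: real^'n. \<Prod>i\<in>UNIV. h i (y $ i)) = (\<lambda>y. \<Prod>i\<in>UNIV. h' i (y $ i))" by auto
  let ?h = "h'(j := deriv (h' j))"
  have "frechet_derivative (\<lambda>y :: real^'n. \<Prod>i\<in>UNIV. h' i (y $ i)) (at x) (axis j 1) =
      (\<Prod>i\<in>UNIV. ?h i (x $ i))" for x
  proof -
    have "frechet_derivative (\<lambda>y :: real^'n. \<Prod>i\<in>UNIV. h' i (y $ i)) (at x) (axis j 1) =
        (\<Sum>i\<in>UNIV. deriv (h' i) (x $ i) * axis j 1 $ i * (\<Prod>k\<in>UNIV - {i}. h' k (x $ k)))"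
      unfolding frechet_derivative_at[OF tensor_product_has_derivative[OF h'(1)], symmetric] ..
    also have "\<dots> = (\<Sum>i\<in>{j}. deriv (h' i) (x $ i) * axis j 1 $ i *
        (\<Prod>k\<in>UNIV - {i}. h' k (x $ k)))"
      by (rule sum.mono_neutral_right) (simp_all add: axis_def)
    also have "\<dots> = deriv (h' j) (x $ j) * (\<Prod>k\<in>UNIV - {j}. h' k (x $ k))"
      by (simp add: axis_def)
    also have "\<dots> = ?h j (x $ j) * (\<Prod>k\<in>UNIV - {j}. ?h k (x $ k))"
      by (intro arg_cong2[where f = "(*)"] prod.cong) simp_all
    also have "\<dots> = (\<Prod>i\<in>UNIV. ?h i (x $ i))"
      by (rule prod.remove[symmetric]) simp_all
    finally show ?thesis .
  qed
  moreover have "\<forall>i. smooth_real (?h i)" using h'(1) smooth_real_deriv(2) by auto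
  ultimately show ?case
    unfolding partials.simps(2) h'(2) by (intro exI[of _ ?h] conjI ext)
qed

lemma smooth_on_tensor_product:
  fixes h :: "'n::finite \<Rightarrow> real \<Rightarrow> real"
  assumes "\<And>i. smooth_real (h i)"
  shows "smooth_on \<Omega> (\<lambda>y :: real^'n. \<Prod>i\<in>UNIV. h i (y $ i))"
  unfolding smooth_on_def
proof
  fix \<alpha> :: "'n list"
  obtain h' where h': "\<And>i. smooth_real (h' i)"
    "partials \<alpha> (\<lambda>y :: real^'n. \<Prod>i\<in>UNIV. h i (y $ i)) = (\<lambda>y. \<Prod>i\<in>UNIV. h' i (y $ i))"
    using partials_tensor_product[of h \<alpha>, OF assms] by auto
  show "partials \<alpha> (\<lambda>y :: real^'n. \<Prod>i\<in>UNIV. h i (y $ i)) differentiable_on \<Omega>"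
    unfolding h'(2)
    by (rule differentiable_at_imp_differentiable_on)
      (rule differentiableI[OF tensor_product_has_derivative[OF h'(1)]])
qed

lemma cutoff_function:
  fixes \<Omega> :: "(real^'n) set"
  assumes "open \<Omega>" "x \<in> \<Omega>"
  obtains \<psi> r where "\<psi> \<in> test_functions \<Omega>" "r > 0" "\<And>y. dist y x < r \<Longrightarrow> \<psi> y = 1"
proof -
  obtain a b where ab: "x \<in> box a b" "cbox a b \<subseteq> \<Omega>"
    using open_contains_cbox[OF assms] by metis
  have "\<exists>h d. smooth_real h \<and> d > 0 \<and> (\<forall>t. \<bar>t - x $ i\<bar> < d \<longrightarrow> h t = 1) \<and>
      (\<forall>t. t \<notin> {a $ i..b $ i} \<longrightarrow> h t = 0)" for i
    using ab(1) smooth_bump_real[of "a $ i" "x $ i" "b $ i"]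
    by (metis mem_box_cart(1))
  then obtain h d where h: "\<And>i. smooth_real (h i)" "\<And>i. d i > 0"
    "\<And>i t. \<bar>t - x $ i\<bar> < d i \<Longrightarrow> h i t = 1" "\<And>i t. t \<notin> {a $ i..b $ i} \<Longrightarrow> h i t = 0"
    by metis
  define \<psi> :: "real^'n \<Rightarrow> real" where "\<psi> = (\<lambda>y. \<Prod>i\<in>UNIV. h i (y $ i))"
  have "{y. \<psi> y \<noteq> 0} \<subseteq> cbox a b"
    using h(4) by (force simp: \<psi>_def mem_box_cart)
  then have sub: "supp \<psi> \<subseteq> cbox a b"
    unfolding supp_def by (rule closure_minimal[OF _ closed_cbox])
  then have "compact (supp \<psi>)"
    by (metis bounded_cbox bounded_subset closed_closure compact_eq_bounded_closed supp_def)
  then have "\<psi> \<in> test_functions \<Omega>"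
    using sub ab(2) smooth_on_tensor_product[OF h(1)] by (auto simp: test_functions_def \<psi>_def)
  moreover have "Min (range d) > 0" using h(2) by simp
  moreover have "\<psi> y = 1" if "dist y x < Min (range d)" for y
  proof -
    have "\<bar>y $ i - x $ i\<bar> < d i" for i
    proof -
      have "\<bar>y $ i - x $ i\<bar> \<le> dist y x" by (metis component_le_norm_cart dist_norm vector_minus_component)
      also have "\<dots> < d i" using that by simp
      finally show ?thesis .
    qed
    then show ?thesis using h(3) by (simp add: \<psi>_def)
  qed
  ultimately show ?thesis using that by blast
qed

lemma smooth_on_imp_continuous_on: "smooth_on \<Omega> f \<Longrightarrow> continuous_on \<Omega> f"
  unfolding smooth_on_def by (metis differentiable_imp_continuous_on partials.simps(1))

section \<open>Independence of the representative\<close>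

text \<open>
  On a compact ball around \<open>x\<close> the net is \<open>O(\<epsilon>)\<close> uniformly. The nets consist of
  smooth, hence continuous functions, so the supremum over the ball is a genuine bound for the
  values.
\<close>

lemma negligible_net_tendsto_0:
  assumes u: "u \<in> negligible_nets \<Omega>" and "open \<Omega>" "x \<in> \<Omega>"
    and e: "filterlim e (at_right 0) A" and X: "(X \<longlongrightarrow> x) A"
  shows "((\<lambda>k. u (e k) (X k)) \<longlongrightarrow> 0) A"
proof -
  obtain r where r: "r > 0" "cball x r \<subseteq> \<Omega>"
    using assms(2,3) open_contains_cball by blast
  let ?K = "cball x r"
  have "compact ?K \<and> ?K \<noteq> {} \<and> ?K \<subseteq> \<Omega>" using r by auto
  then have "(\<lambda>\<epsilon>. SUP x\<in>?K. \<bar>u \<epsilon> x\<bar>) \<in> O[at_right 0](\<lambda>\<epsilon>. \<epsilon> powr 1)"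
    using u unfolding negligible_nets_def by blast
  then obtain c where c:
    "eventually (\<lambda>\<epsilon>. norm (SUP x\<in>?K. \<bar>u \<epsilon> x\<bar>) \<le> c * norm (\<epsilon> powr 1)) (at_right 0)"
    by (elim landau_o.bigE)
  have "eventually (\<lambda>\<epsilon>::real. \<epsilon> \<in> {0<..1}) (at_right 0)"
    using eventually_at_right_real[of 0 1] by (auto elim: eventually_mono)
  with c have "eventually (\<lambda>\<epsilon>. \<forall>y\<in>?K. \<bar>u \<epsilon> y\<bar> \<le> c * \<epsilon>) (at_right 0)"
  proof eventually_elim
    case (elim \<epsilon>)
    have "smooth_on \<Omega> (u \<epsilon>)"
      using u elim(2) by (auto simp: negligible_nets_def moderate_nets_def)
    then have "continuous_on ?K (\<lambda>y. \<bar>u \<epsilon> y\<bar>)"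
      using r(2) by (intro continuous_intros continuous_on_subset[OF smooth_on_imp_continuous_on])
    then have "bdd_above ((\<lambda>y. \<bar>u \<epsilon> y\<bar>) ` ?K)"
      by (intro bounded_imp_bdd_above compact_imp_bounded compact_continuous_image) auto
    then have "\<bar>u \<epsilon> y\<bar> \<le> (SUP y\<in>?K. \<bar>u \<epsilon> y\<bar>)" if "y \<in> ?K" for y
      using that by (intro cSUP_upper)
    then show ?case using elim by fastforce
  qed
  then have "eventually (\<lambda>k. \<forall>y\<in>?K. \<bar>u (e k) y\<bar> \<le> c * e k) A"
    using e by (rule eventually_compose_filterlim)
  moreover have "eventually (\<lambda>k. X k \<in> ?K) A"
    using tendstoD[OF X r(1)] by (auto elim: eventually_mono simp: dist_commute)
  ultimately have "eventually (\<lambda>k. norm (u (e k) (X k)) \<le> c * e k) A"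
    by eventually_elim simp
  moreover have "((\<lambda>k. c * e k) \<longlongrightarrow> 0) A"
    using e by (intro tendsto_mult_right_zero) (simp add: filterlim_at)
  ultimately show ?thesis by (rule Lim_null_comparison)
qed

lemma representatives_diff_tendsto_0:
  fixes F :: "('n::finite, 'm::finite) gen_map"
  assumes "open \<Omega>" "x \<in> \<Omega>" and F: "\<And>i. F $ i \<in> colombeau \<Omega>"
    and f: "represents f F" and g: "represents g F"
    and e: "filterlim e (at_right 0) A" and X: "(X \<longlongrightarrow> x) A"
  shows "((\<lambda>k. f (e k) (X k) - g (e k) (X k)) \<longlongrightarrow> 0) A"
proof (rule vec_tendstoI)
  fix i
  obtain u where u: "F $ i = colombeau_rel \<Omega> `` {u}"
    using F[of i] unfolding colombeau_def by (elim quotientE)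
  have "((\<lambda>k. u (e k) (X k) - h (e k) (X k) $ i) \<longlongrightarrow> 0) A" if "represents h F" for h
  proof -
    have "(\<lambda>\<epsilon> x. h \<epsilon> x $ i) \<in> F $ i" using that by (simp add: represents_def)
    then have "(\<lambda>\<epsilon> x. u \<epsilon> x - h \<epsilon> x $ i) \<in> negligible_nets \<Omega>"
      by (simp add: u colombeau_rel_def)
    from negligible_net_tendsto_0[OF this assms(1,2) e X] show ?thesis .
  qed
  from tendsto_diff[OF this[OF g] this[OF f]]
  show "((\<lambda>k. (f (e k) (X k) - g (e k) (X k)) $ i) \<longlongrightarrow> 0 $ i) A" by simp
qed

lemma filterlim_reparam:
  assumes "\<tau> \<in> reparams"
  shows "filterlim \<tau> (at_right 0) (at_right 0)"
proof -
  have "eventually (\<lambda>\<epsilon>::real. \<epsilon> \<in> {0<..<1}) (at_right 0)"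
    by (rule eventually_at_right_real) simp
  then have "eventually (\<lambda>\<epsilon>. \<tau> \<epsilon> \<in> {0<..} \<and> \<tau> \<epsilon> \<noteq> 0) (at_right 0)"
    by (rule eventually_mono) (use assms in \<open>force simp: reparams_def image_subset_iff\<close>)
  then show ?thesis using assms by (simp add: filterlim_at reparams_def)
qed

section \<open>Description of the generalized graph by one representative\<close>

text \<open>
  From left to right, both reparametrizations are absorbed into one parameter \<open>\<tau>(\<sigma>(\<epsilon>))\<close>, and the
  representative may be exchanged for \<open>f\<close> because the difference tends to \<open>0\<close>. Conversely, choosing
  parameter and point for each \<open>d\<close> gives nets indexed by \<open>d\<close> itself; these converge already, so the
  second reparametrization can be the identity.
\<close>

lemma gen_graph_iff:
  fixes F :: "('n::finite, 'm::finite) gen_map"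
  assumes "open \<Omega>1" and F: "\<And>i. F $ i \<in> colombeau \<Omega>1" and f: "represents f F"
  shows "(x, y) \<in> gen_graph \<Omega>1 \<Omega>2 F \<longleftrightarrow> x \<in> \<Omega>1 \<and> y \<in> \<Omega>2 \<and>
    (\<forall>d>0. \<exists>\<epsilon>\<in>{0<..<d}. \<exists>x'\<in>\<Omega>1. dist x' x < d \<and> dist (f \<epsilon> x') y < d)"
proof (intro iffI conjI allI impI)
  assume "(x, y) \<in> gen_graph \<Omega>1 \<Omega>2 F"
  then obtain h xs \<tau> \<sigma> where x: "x \<in> \<Omega>1" and y: "y \<in> \<Omega>2" and h: "represents h F"
    and xs: "xs ` {0<..1} \<subseteq> \<Omega>1" "(xs \<longlongrightarrow> x) (at_right 0)" and \<tau>: "\<tau> \<in> reparams"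
    and \<sigma>: "\<sigma> \<in> reparams" and lim: "((\<lambda>\<epsilon>. h (\<tau> (\<sigma> \<epsilon>)) (xs (\<sigma> \<epsilon>))) \<longlongrightarrow> y) (at_right 0)"
    unfolding gen_graph_def cluster_point_def by blast
  show "x \<in> \<Omega>1" "y \<in> \<Omega>2" by fact+
  fix d :: real assume d: "d > 0"
  have \<tau>\<sigma>: "filterlim (\<lambda>\<epsilon>. \<tau> (\<sigma> \<epsilon>)) (at_right 0) (at_right 0)"
    using filterlim_compose[OF filterlim_reparam[OF \<tau>] filterlim_reparam[OF \<sigma>]] .
  have X: "((\<lambda>\<epsilon>. xs (\<sigma> \<epsilon>)) \<longlongrightarrow> x) (at_right 0)"
    using filterlim_compose[OF xs(2) filterlim_reparam[OF \<sigma>]] .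
  have "((\<lambda>\<epsilon>. f (\<tau> (\<sigma> \<epsilon>)) (xs (\<sigma> \<epsilon>))) \<longlongrightarrow> y) (at_right 0)"
    using tendsto_add[OF representatives_diff_tendsto_0[OF assms(1) x F f h \<tau>\<sigma> X] lim] by simp
  from tendstoD[OF this d] tendstoD[OF X d]
    eventually_compose_filterlim[OF eventually_at_right_real[OF d] \<tau>\<sigma>]
    eventually_at_right_real[OF zero_less_one]
  have "eventually (\<lambda>\<epsilon>. \<tau> (\<sigma> \<epsilon>) \<in> {0<..<d} \<and> xs (\<sigma> \<epsilon>) \<in> \<Omega>1 \<and> dist (xs (\<sigma> \<epsilon>)) x < d \<and>
      dist (f (\<tau> (\<sigma> \<epsilon>)) (xs (\<sigma> \<epsilon>))) y < d) (at_right (0::real))"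
  proof eventually_elim
    case (elim \<epsilon>)
    then have "\<sigma> \<epsilon> \<in> {0<..1}" using \<sigma> by (auto simp: reparams_def image_subset_iff)
    then show ?case using elim xs(1) by blast
  qed
  then show "\<exists>\<epsilon>\<in>{0<..<d}. \<exists>x'\<in>\<Omega>1. dist x' x < d \<and> dist (f \<epsilon> x') y < d"
    by (metis (no_types, lifting) eventually_happens' trivial_limit_at_right_real)
next
  assume *: "x \<in> \<Omega>1 \<and> y \<in> \<Omega>2 \<and>
    (\<forall>d>0. \<exists>\<epsilon>\<in>{0<..<d}. \<exists>x'\<in>\<Omega>1. dist x' x < d \<and> dist (f \<epsilon> x') y < d)"
  then obtain \<tau> xs where \<tau>: "\<And>d. d > 0 \<Longrightarrow> \<tau> d \<in> {0<..<d}"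
    and xs: "\<And>d. d > 0 \<Longrightarrow> xs d \<in> \<Omega>1" "\<And>d. d > 0 \<Longrightarrow> dist (xs d) x < d"
    "\<And>d. d > 0 \<Longrightarrow> dist (f (\<tau> d) (xs d)) y < d" by metis
  have id: "((\<lambda>d. d) \<longlongrightarrow> 0) (at_right (0::real))" by (rule tendsto_ident_at)
  have small: "(g \<longlongrightarrow> l) (at_right 0)" if "\<And>d. d > 0 \<Longrightarrow> dist (g d) l < d"
    for g :: "real \<Rightarrow> 'z::metric_space" and l
  proof (rule metric_tendsto_imp_tendsto[OF id])
    show "eventually (\<lambda>d. dist (g d) l \<le> dist d 0) (at_right 0)"
      using eventually_at_right_less[of "0::real"]
      by eventually_elim (simp add: that less_imp_le)
  qed
  have "\<tau> \<in> reparams"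
    using \<tau> by (force simp: reparams_def dist_real_def intro!: small)
  moreover have "cluster_point (\<lambda>\<epsilon>. f (\<tau> \<epsilon>) (xs \<epsilon>)) y"
    unfolding cluster_point_def
    by (rule bexI[of _ "\<lambda>d. d"]) (use small[OF xs(3)] id in \<open>auto simp: reparams_def\<close>)
  moreover have "xs ` {0<..1} \<subseteq> \<Omega>1" "(xs \<longlongrightarrow> x) (at_right 0)"
    using xs(1) small[OF xs(2)] by auto
  ultimately show "(x, y) \<in> gen_graph \<Omega>1 \<Omega>2 F"
    using * f unfolding gen_graph_def by blast
qed

section \<open>Embedded continuous functions\<close>

lemma integral_mult_scaled:
  fixes g \<rho> :: "real^'n \<Rightarrow> real"
  assumes [measurable]: "g \<in> borel_measurable borel" "\<rho> \<in> borel_measurable borel" and "\<epsilon> > 0"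
  shows "(LINT y|lborel. g y * scaled \<rho> \<epsilon> (x - y)) = (LINT z|lborel. g (x - \<epsilon> *\<^sub>R z) * \<rho> z)"
proof -
  have [measurable]: "(\<lambda>y. g y * scaled \<rho> \<epsilon> (x - y)) \<in> borel_measurable borel"
    unfolding scaled_def by measurable
  have "(LINT y|lborel. g y * scaled \<rho> \<epsilon> (x - y)) =
      (LINT y|density (distr lborel borel (\<lambda>z. x + (- \<epsilon>) *\<^sub>R z)) (\<lambda>_. \<bar>- \<epsilon>\<bar> ^ DIM(real^'n)).
        g y * scaled \<rho> \<epsilon> (x - y))"
    using lborel_affine[of "- \<epsilon>" x] assms(3) by simp
  also have "\<dots> = (LINT z|lborel. g (x - \<epsilon> *\<^sub>R z) * \<rho> z)"
    using assms(3) by (subst integral_density) (auto simp: integral_distr scaled_def)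
  finally show ?thesis .
qed

lemma mollification_tendsto:
  fixes g \<rho> :: "real^'n \<Rightarrow> real"
  assumes g: "continuous_on UNIV g" "bounded (range g)"
    and \<rho>: "integrable lborel \<rho>" "(LINT z|lborel. \<rho> z) = 1"
    and e: "filterlim e (at_right 0) sequentially" and X: "X \<longlonglongrightarrow> x"
  shows "(\<lambda>k. LINT y|lborel. g y * scaled \<rho> (e k) (X k - y)) \<longlonglongrightarrow> g x"
proof -
  have [measurable]: "g \<in> borel_measurable borel" "\<rho> \<in> borel_measurable borel"
    using g(1) \<rho>(1) by (auto intro: borel_measurable_continuous_onI)
  obtain B where B: "\<And>y. \<bar>g y\<bar> \<le> B"
    using g(2) by (auto simp: bounded_iff)
  have "(\<lambda>k. LINT z|lborel. g (X k - e k *\<^sub>R z) * \<rho> z) \<longlonglongrightarrow> (LINT z|lborel. g x * \<rho> z)"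
  proof (rule integral_dominated_convergence[where w = "\<lambda>z. B * \<bar>\<rho> z\<bar>"])
    show "integrable lborel (\<lambda>z. B * \<bar>\<rho> z\<bar>)" using \<rho>(1) by simp
    show "AE z in lborel. (\<lambda>k. g (X k - e k *\<^sub>R z) * \<rho> z) \<longlonglongrightarrow> g x * \<rho> z"
    proof (intro AE_I2 tendsto_mult tendsto_const)
      fix z
      have "e \<longlonglongrightarrow> 0" using e by (simp add: filterlim_at)
      then have "(\<lambda>k. X k - e k *\<^sub>R z) \<longlonglongrightarrow> x - 0 *\<^sub>R z"
        by (intro tendsto_intros X)
      moreover have "isCont g x" using g(1) by (simp add: continuous_on_eq_continuous_at)
      ultimately show "(\<lambda>k. g (X k - e k *\<^sub>R z)) \<longlonglongrightarrow> g x"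
        using isCont_tendsto_compose[of x g] by simp
    qed
    show "AE z in lborel. norm (g (X k - e k *\<^sub>R z) * \<rho> z) \<le> B * \<bar>\<rho> z\<bar>" for k
      using B by (intro AE_I2) (simp add: abs_mult mult_right_mono)
  qed auto
  moreover have "eventually (\<lambda>k. (LINT z|lborel. g (X k - e k *\<^sub>R z) * \<rho> z) =
      (LINT y|lborel. g y * scaled \<rho> (e k) (X k - y))) sequentially"
  proof -
    have "eventually (\<lambda>k. e k > 0) sequentially"
      using e by (auto simp: filterlim_at elim: eventually_mono)
    then show ?thesis by eventually_elim (simp add: integral_mult_scaled)
  qed
  ultimately show ?thesis
    using \<rho>(2) by (simp add: Lim_transform_eventually)
qed

text \<open>
  On a small ball the net \<open>f\<close> is, up to a negligible net, the mollification of \<open>h = \<psi> g\<close> extended by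
  zero. This extension is continuous and bounded on the whole space because \<open>\<psi>\<close> has compact support
  in \<open>\<Omega>\<close>, and \<open>h x = g x\<close>.
\<close>

lemma iota_continuous_tendsto:
  fixes g \<rho> :: "real^'n \<Rightarrow> real"
  assumes \<rho>: "mollifier \<rho>" and "open \<Omega>" "x \<in> \<Omega>" and g: "continuous_on \<Omega> g"
    and f: "f \<in> iota \<rho> \<Omega> (regular_distribution \<Omega> g)"
    and e: "filterlim e (at_right 0) sequentially" and X: "X \<longlonglongrightarrow> x"
  shows "(\<lambda>k. f (e k) (X k)) \<longlonglongrightarrow> g x"
proof -
  obtain \<psi> r where \<psi>: "\<psi> \<in> test_functions \<Omega>" and r: "r > 0" "\<And>y. dist y x < r \<Longrightarrow> \<psi> y = 1"
    using cutoff_function[OF assms(2,3)] by blast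
  let ?\<omega> = "ball x (r / 2)" and ?c = "cutoff_convolution (regular_distribution \<Omega> g) \<psi> \<rho>"
  have supp: "compact (supp \<psi>)" "supp \<psi> \<subseteq> \<Omega>" using \<psi> by (auto simp: test_functions_def)
  have out: "\<psi> y = 0" if "y \<notin> supp \<psi>" for y using that by (rule test_function_outside)
  have sub: "ball x r \<subseteq> \<Omega>"
  proof
    fix y assume "y \<in> ball x r"
    then have "\<psi> y \<noteq> 0" using r(2)[of y] by (simp add: dist_commute)
    then show "y \<in> \<Omega>" using out supp(2) by blast
  qed
  have cl: "closure ?\<omega> \<subseteq> ball x r" using r(1) by auto
  have "(f, ?c) \<in> colombeau_rel ?\<omega>"
  proof -
    have "open ?\<omega> \<and> compact (closure ?\<omega>) \<and> closure ?\<omega> \<subseteq> \<Omega> \<and> \<psi> \<in> test_functions \<Omega> \<and>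
         (\<exists>V. open V \<and> closure ?\<omega> \<subseteq> V \<and> (\<forall>x\<in>V. \<psi> x = 1))"
      using cl sub \<psi> r by (intro conjI exI[of _ "ball x r"]) (auto simp: dist_commute)
    then show ?thesis using f unfolding iota_def by blast
  qed
  then have "(\<lambda>\<epsilon> x. f \<epsilon> x - ?c \<epsilon> x) \<in> negligible_nets ?\<omega>"
    by (simp add: colombeau_rel_def)
  then have diff: "(\<lambda>k. f (e k) (X k) - ?c (e k) (X k)) \<longlonglongrightarrow> 0"
    using r(1) by (intro negligible_net_tendsto_0[OF _ _ _ e X]) auto
  define h where "h = (\<lambda>y. indicator \<Omega> y * (g y * \<psi> y))"
  have "continuous_on (\<Omega> \<union> - supp \<psi>) h"
  proof (rule continuous_on_open_Un)
    have "continuous_on \<Omega> (\<lambda>y. g y * \<psi> y)"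
      using g continuous_on_subset[OF test_function_continuous[OF \<psi>]]
      by (intro continuous_on_mult) auto
    then show "continuous_on \<Omega> h"
      by (rule continuous_on_eq) (simp add: h_def)
    show "continuous_on (- supp \<psi>) h"
      by (rule continuous_on_eq[OF continuous_on_const[of _ 0]]) (simp add: h_def out)
    show "open (- supp \<psi>)" using supp(1) by (simp add: compact_imp_closed open_Compl)
  qed fact
  moreover have "\<Omega> \<union> - supp \<psi> = UNIV" using supp(2) by blast
  ultimately have h: "continuous_on UNIV h" by simp
  have "h y = 0" if "y \<notin> supp \<psi>" for y using out[OF that] by (simp add: h_def)
  then have "range h \<subseteq> insert 0 (h ` supp \<psi>)" by blast
  moreover have "compact (h ` supp \<psi>)"
    using compact_continuous_image[OF continuous_on_subset[OF h] supp(1)] by simp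
  ultimately have h_bounded: "bounded (range h)"
    by (meson bounded_insert bounded_subset compact_imp_bounded)
  have \<rho>1: "(LINT z|lborel. \<rho> z) = 1" using \<rho> by (simp add: mollifier_def)
  \<comment> \<open>The Bochner integral of a non-integrable function is \<open>0\<close> by convention, so integral \<open>1\<close>
      forces integrability.\<close>
  then have "integrable lborel \<rho>" using not_integrable_integral_eq by fastforce
  note mollification_tendsto[OF h h_bounded this \<rho>1 e X]
  moreover have "(LINT y|lborel. h y * scaled \<rho> \<epsilon> (x - y)) = ?c \<epsilon> x" for \<epsilon> x
    unfolding cutoff_convolution_def regular_distribution_def set_lebesgue_integral_def h_def
    by (simp add: mult_ac)
  moreover have "h x = g x" using assms(3) r by (simp add: h_def)
  ultimately have "(\<lambda>k. ?c (e k) (X k)) \<longlonglongrightarrow> g x" by simp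
  from tendsto_add[OF diff this] show ?thesis by simp
qed

section \<open>The generalized graph of a c-bounded map\<close>

lemma gen_graph_value_in_closed:
  fixes F :: "('n::finite, 'm::finite) gen_map"
  assumes "open \<Omega>1" and F: "\<And>i. F $ i \<in> colombeau \<Omega>1" and f: "represents f F"
    and "closed K'" and K': "\<And>\<epsilon>. \<epsilon> \<in> {0<..1} \<Longrightarrow> f \<epsilon> ` K \<subseteq> K'"
    and x: "x \<in> interior K" and xy: "(x, y) \<in> gen_graph \<Omega>1 \<Omega>2 F"
  shows "y \<in> K'"
proof -
  obtain r where r: "r > 0" "ball x r \<subseteq> K" using x by (auto simp: mem_interior)
  have "\<exists>z\<in>K'. dist z y < d" if "d > 0" for d
  proof -
    have "min d (min r 1) > 0" using that r(1) by simp
    then obtain \<epsilon> x' where *: "\<epsilon> \<in> {0<..<min d (min r 1)}" "dist x' x < min d (min r 1)"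
      "dist (f \<epsilon> x') y < min d (min r 1)"
      using xy unfolding gen_graph_iff[OF assms(1) F f] by metis
    then have "x' \<in> K" using r(2) by (auto simp: dist_commute)
    then have "f \<epsilon> x' \<in> K'" using K'[of \<epsilon>] *(1) by auto
    then show ?thesis using *(3) by auto
  qed
  then show ?thesis
    unfolding closed_approachable[OF \<open>closed K'\<close>, symmetric] by blast
qed

text \<open>
  A point of accumulation of \<open>f \<epsilon> x\<close> for the constant net \<open>x\<close> lies in the fibre. Compactness is needed
  inside \<open>\<Omega>2\<close>: otherwise the values could escape to its boundary.
\<close>

lemma gen_graph_at_nonempty:
  fixes F :: "('n::finite, 'm::finite) gen_map"
  assumes "open \<Omega>1" and F: "\<And>i. F $ i \<in> colombeau \<Omega>1" and f: "represents f F"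
    and "x \<in> \<Omega>1" and "compact K'" "K' \<subseteq> \<Omega>2" and K': "\<And>\<epsilon>. \<epsilon> \<in> {0<..1} \<Longrightarrow> f \<epsilon> x \<in> K'"
  shows "gen_graph_at \<Omega>1 \<Omega>2 F x \<noteq> {}"
proof -
  have "f (inverse (real (Suc k))) x \<in> K'" for k by (intro K') (simp add: field_simps)
  then obtain y s where y: "y \<in> K'" and s: "strict_mono s"
    and lim: "((\<lambda>k. f (inverse (real (Suc k))) x) \<circ> s) \<longlonglongrightarrow> y"
    using \<open>compact K'\<close> unfolding compact_def by metis
  have "\<exists>\<epsilon>\<in>{0<..<d}. \<exists>x'\<in>\<Omega>1. dist x' x < d \<and> dist (f \<epsilon> x') y < d" if d: "d > 0" for d
  proof -
    have "(\<lambda>k. inverse (real (Suc (s k)))) \<longlonglongrightarrow> 0"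
      using LIMSEQ_subseq_LIMSEQ[OF LIMSEQ_inverse_real_of_nat s] by (simp add: o_def)
    from order_tendstoD(2)[OF this d] tendstoD[OF lim d]
    have "eventually (\<lambda>k. inverse (real (Suc (s k))) < d \<and>
        dist (f (inverse (real (Suc (s k)))) x) y < d) sequentially"
      by eventually_elim simp
    then obtain k where "inverse (real (Suc (s k))) < d"
        "dist (f (inverse (real (Suc (s k)))) x) y < d"
      by (auto dest: eventually_happens)
    then show ?thesis
      using d \<open>x \<in> \<Omega>1\<close> by (intro bexI[of _ "inverse (real (Suc (s k)))"] bexI[of _ x]) auto
  qed
  then have "(x, y) \<in> gen_graph \<Omega>1 \<Omega>2 F"
    using y \<open>K' \<subseteq> \<Omega>2\<close> \<open>x \<in> \<Omega>1\<close> unfolding gen_graph_iff[OF assms(1) F f] by auto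
  then show ?thesis using y \<open>K' \<subseteq> \<Omega>2\<close> by (auto simp: gen_graph_at_def)
qed

lemma closedin_gen_graph:
  fixes F :: "('n::finite, 'm::finite) gen_map"
  assumes "open \<Omega>1" and F: "\<And>i. F $ i \<in> colombeau \<Omega>1" and f: "represents f F"
  shows "closedin (top_of_set (\<Omega>1 \<times> \<Omega>2)) (gen_graph \<Omega>1 \<Omega>2 F)"
proof -
  let ?\<Gamma> = "gen_graph \<Omega>1 \<Omega>2 F"
  have "?\<Gamma> \<subseteq> \<Omega>1 \<times> \<Omega>2" by (auto simp: gen_graph_def)
  moreover have "p \<in> ?\<Gamma>" if p: "p \<in> \<Omega>1 \<times> \<Omega>2" "p \<in> closure ?\<Gamma>" for p
  proof -
    obtain x y where xy: "p = (x, y)" by fastforce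
    have "\<exists>\<epsilon>\<in>{0<..<d}. \<exists>x'\<in>\<Omega>1. dist x' x < d \<and> dist (f \<epsilon> x') y < d" if d: "d > 0" for d
    proof -
      obtain q where q: "q \<in> ?\<Gamma>" "dist q p < d / 2"
        using p(2) d by (auto simp: closure_approachable dest: spec[of _ "d / 2"])
      obtain u v where uv: "q = (u, v)" by fastforce
      obtain \<epsilon> x' where *: "\<epsilon> \<in> {0<..<d / 2}" "x' \<in> \<Omega>1" "dist x' u < d / 2"
        "dist (f \<epsilon> x') v < d / 2"
        using q(1) d unfolding uv gen_graph_iff[OF assms(1) F f] by (metis half_gt_zero)
      have "dist u x < d / 2" "dist v y < d / 2"
        using q(2) dist_fst_le[of q p] dist_snd_le[of q p] by (auto simp: uv xy)
      then have "dist x' x < d" "dist (f \<epsilon> x') y < d"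
        using *(3,4) dist_triangle_half_l dist_commute by (metis dist_triangle_half_r)+
      then show ?thesis using * by auto
    qed
    then show ?thesis using p(1) unfolding xy gen_graph_iff[OF assms(1) F f] by auto
  qed
  ultimately have "?\<Gamma> = (\<Omega>1 \<times> \<Omega>2) \<inter> closure ?\<Gamma>" using closure_subset by blast
  then show ?thesis by (metis closed_closure closedin_closed)
qed

text \<open>
  The description by one representative yields sequences \<open>\<epsilon>\<^sub>k \<rightarrow> 0\<close> and \<open>x\<^sub>k \<rightarrow> x\<close> with
  \<open>f \<epsilon>\<^sub>k x\<^sub>k \<rightarrow> y\<close>, while the embedding forces the limit \<open>G x\<close>.
\<close>

lemma gen_graph_subset_graph:
  fixes F :: "('n::finite, 'm::finite) gen_map" and G :: "real^'n \<Rightarrow> real^'m"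
  assumes "open \<Omega>1" and F: "\<And>i. F $ i \<in> colombeau \<Omega>1" and f: "represents f F"
    and "mollifier \<rho>" and G: "continuous_on \<Omega>1 G"
    and F_eq: "F = (\<chi> i. iota \<rho> \<Omega>1 (regular_distribution \<Omega>1 (\<lambda>x. G x $ i)))"
    and xy: "(x, y) \<in> gen_graph \<Omega>1 \<Omega>2 F"
  shows "y = G x"
proof -
  have x: "x \<in> \<Omega>1" using xy by (simp add: gen_graph_def)
  have "\<forall>k. \<exists>\<epsilon> x'. \<epsilon> \<in> {0<..<inverse (real (Suc k))} \<and>
      dist x' x < inverse (real (Suc k)) \<and> dist (f \<epsilon> x') y < inverse (real (Suc k))"
    using xy unfolding gen_graph_iff[OF assms(1) F f]
    by (metis inverse_positive_iff_positive of_nat_0_less_iff zero_less_Suc)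
  then obtain e X where e: "\<And>k. e k \<in> {0<..<inverse (real (Suc k))}"
    and X: "\<And>k. dist (X k) x < inverse (real (Suc k))"
    and Y: "\<And>k. dist (f (e k) (X k)) y < inverse (real (Suc k))" by metis
  have small: "s \<longlonglongrightarrow> l" if "\<And>k. dist (s k) l < inverse (real (Suc k))"
    for s :: "nat \<Rightarrow> 'z::metric_space" and l
    by (rule metric_tendsto_imp_tendsto[OF LIMSEQ_inverse_real_of_nat])
      (use that in \<open>auto simp: less_imp_le\<close>)
  have "dist (e k) 0 < inverse (real (Suc k))" for k
    using e[of k] by (simp add: dist_real_def)
  then have "e \<longlonglongrightarrow> 0" by (rule small)
  then have e': "filterlim e (at_right 0) sequentially"
    using e by (simp add: filterlim_at order_less_imp_not_eq2 always_eventually)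
  have "(\<lambda>k. f (e k) (X k)) \<longlonglongrightarrow> G x"
  proof (rule vec_tendstoI)
    fix i
    have "(\<lambda>\<epsilon> x. f \<epsilon> x $ i) \<in> iota \<rho> \<Omega>1 (regular_distribution \<Omega>1 (\<lambda>x. G x $ i))"
      using f by (simp add: represents_def F_eq)
    then show "(\<lambda>k. f (e k) (X k) $ i) \<longlonglongrightarrow> G x $ i"
      by (rule iota_continuous_tendsto[OF assms(4,1) x continuous_on_component[OF G] _ e' small[OF X]])
  qed
  with small[OF Y] show ?thesis by (rule LIMSEQ_unique)
qed

theorem theorem2p1p8:
  fixes \<Omega>1 :: "(real^'n) set" and \<Omega>2 :: "(real^'m) set" and F :: "('n, 'm) gen_map"
  assumes "open \<Omega>1" and "open \<Omega>2"
    and "F \<in> c_bounded \<Omega>1 \<Omega>2"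
  shows "(\<forall>(\<rho> :: real^'n \<Rightarrow> real) (G :: real^'n \<Rightarrow> real^'m).
            mollifier \<rho> \<and> continuous_on \<Omega>1 G \<and> G ` \<Omega>1 \<subseteq> \<Omega>2 \<and>
            F = (\<chi> i. iota \<rho> \<Omega>1 (regular_distribution \<Omega>1 (\<lambda>x. G x $ i)))
            \<longrightarrow> gen_graph \<Omega>1 \<Omega>2 F = {(x, G x) | x. x \<in> \<Omega>1})
       \<and> gen_graph_at \<Omega>1 \<Omega>2 F \<in> \<Omega>1 \<rightarrow> nonempty_closed_subsets \<Omega>2
       \<and> closed_svmap \<Omega>1 \<Omega>2 (gen_graph_at \<Omega>1 \<Omega>2 F)
       \<and> locally_bounded_svmap \<Omega>1 (gen_graph_at \<Omega>1 \<Omega>2 F)"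
proof -
  have F: "\<And>i. F $ i \<in> colombeau \<Omega>1" using assms(3) by (simp add: c_bounded_def)
  obtain f where f: "represents f F"
    and bound: "\<And>K. compact K \<Longrightarrow> K \<subseteq> \<Omega>1 \<Longrightarrow>
      \<exists>K'. compact K' \<and> K' \<subseteq> \<Omega>2 \<and> (\<forall>\<epsilon>\<in>{0<..1}. f \<epsilon> ` K \<subseteq> K')"
    using assms(3) unfolding c_bounded_def mem_Collect_eq by metis
  let ?A = "gen_graph_at \<Omega>1 \<Omega>2 F"
  have nonempty: "?A x \<noteq> {}" if x: "x \<in> \<Omega>1" for x
  proof -
    have "{x} \<subseteq> \<Omega>1" using x by simp
    from bound[OF compact_sing this] obtain K' where K': "compact K'" "K' \<subseteq> \<Omega>2"
      "\<forall>\<epsilon>\<in>{0<..1}. f \<epsilon> ` {x} \<subseteq> K'" by (elim exE conjE)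
    have "f \<epsilon> x \<in> K'" if "\<epsilon> \<in> {0<..1}" for \<epsilon>
      using bspec[OF K'(3) that] by (rule subsetD) simp
    then show ?thesis by (rule gen_graph_at_nonempty[OF assms(1) F f x K'(1,2)])
  qed
  have closed_graph: "closedin (top_of_set (\<Omega>1 \<times> \<Omega>2)) (gen_graph \<Omega>1 \<Omega>2 F)"
    by (rule closedin_gen_graph[OF assms(1) F f])
  have classical: "gen_graph \<Omega>1 \<Omega>2 F = {(x, G x) | x. x \<in> \<Omega>1}"
    if "mollifier \<rho>" "continuous_on \<Omega>1 G"
      "F = (\<chi> i. iota \<rho> \<Omega>1 (regular_distribution \<Omega>1 (\<lambda>x. G x $ i)))" for \<rho> and G :: "real^'n \<Rightarrow> real^'m"
  proof -
    note G = gen_graph_subset_graph[OF assms(1) F f that]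
    \<comment> \<open>The fibre over \<open>x\<close> is non-empty and contains at most \<open>G x\<close>.\<close>
    have "(x, G x) \<in> gen_graph \<Omega>1 \<Omega>2 F" if "x \<in> \<Omega>1" for x
      using nonempty[OF that] G by (auto simp: gen_graph_at_def)
    moreover have "x \<in> \<Omega>1 \<and> y = G x" if "(x, y) \<in> gen_graph \<Omega>1 \<Omega>2 F" for x y
      using that G[OF that] by (simp add: gen_graph_def)
    ultimately have "(x, y) \<in> gen_graph \<Omega>1 \<Omega>2 F \<longleftrightarrow> x \<in> \<Omega>1 \<and> y = G x" for x y by blast
    then show ?thesis by (intro set_eqI) (auto simp: split_paired_all)
  qed
  have set_valued: "?A \<in> \<Omega>1 \<rightarrow> nonempty_closed_subsets \<Omega>2"
  proof
    fix x assume x: "x \<in> \<Omega>1"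
    have "closedin (top_of_set \<Omega>2) {y \<in> \<Omega>2. (x, y) \<in> gen_graph \<Omega>1 \<Omega>2 F}"
    proof -
      obtain T where T: "closed T" "gen_graph \<Omega>1 \<Omega>2 F = (\<Omega>1 \<times> \<Omega>2) \<inter> T"
        using closed_graph unfolding closedin_closed by blast
      have "closed (Pair x -` T)"
        using T(1) by (intro closed_vimage continuous_intros)
      moreover have "{y \<in> \<Omega>2. (x, y) \<in> gen_graph \<Omega>1 \<Omega>2 F} = \<Omega>2 \<inter> Pair x -` T"
        using x unfolding T(2) by blast
      ultimately show ?thesis unfolding closedin_closed by blast
    qed
    then show "?A x \<in> nonempty_closed_subsets \<Omega>2"
      using nonempty[OF x] by (simp add: nonempty_closed_subsets_def gen_graph_at_def)
  qed
  have closed_map: "closed_svmap \<Omega>1 \<Omega>2 ?A"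
  proof -
    have "{(x, y). x \<in> \<Omega>1 \<and> y \<in> ?A x} = gen_graph \<Omega>1 \<Omega>2 F"
      by (auto simp: gen_graph_at_def gen_graph_def)
    then show ?thesis using closed_graph by (simp add: closed_svmap_def)
  qed
  have locally_bounded: "locally_bounded_svmap \<Omega>1 ?A"
    unfolding locally_bounded_svmap_def
  proof
    fix x assume "x \<in> \<Omega>1"
    then obtain r where r: "r > 0" "cball x r \<subseteq> \<Omega>1"
      using \<open>open \<Omega>1\<close> open_contains_cball by blast
    from bound[OF compact_cball r(2)] obtain K' where K': "compact K'" "K' \<subseteq> \<Omega>2"
      "\<forall>\<epsilon>\<in>{0<..1}. f \<epsilon> ` cball x r \<subseteq> K'" by (elim exE conjE)
    have "?A x' \<subseteq> K'" if "x' \<in> ball x r" for x'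
    proof
      fix y assume "y \<in> ?A x'"
      then have "(x', y) \<in> gen_graph \<Omega>1 \<Omega>2 F" by (simp add: gen_graph_at_def)
      moreover have "x' \<in> interior (cball x r)" using that by (simp add: interior_cball)
      ultimately show "y \<in> K'"
        by (intro gen_graph_value_in_closed[OF assms(1) F f compact_imp_closed[OF K'(1)]
              bspec[OF K'(3)]])
    qed
    then have "(\<Union>x'\<in>ball x r. ?A x') \<subseteq> K'" by (rule UN_least)
    then have "bounded (\<Union>x'\<in>ball x r. ?A x')"
      using compact_imp_bounded[OF K'(1)] bounded_subset by metis
    moreover have "ball x r \<subseteq> \<Omega>1" using ball_subset_cball r(2) by (rule subset_trans)
    moreover have "x \<in> interior (ball x r)" using r(1) by (simp add: interior_open)
    ultimately show "\<exists>X\<subseteq>\<Omega>1. x \<in> interior X \<and> bounded (\<Union>x'\<in>X. ?A x')"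
      by (intro exI[of _ "ball x r"] conjI)
  qed
  show ?thesis
    using classical set_valued closed_map locally_bounded by (intro conjI allI impI) (elim conjE)
qed

end
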